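(* Let $k\ge 1$ and let the consumer's (concave) satisfaction function $f:Y\to\mathbb{R}$ be a polynomial of degree $k+1$. Let $y^{(0)}\in(0,\bar y)$, let $\gamma^{(0)},\gamma^{(1)}\in\Gamma$ be given a priori, and run the iterative estimation and incentive-design algorithm described in the context. Suppose that at each iteration $\ell$ of the algorithm ($\ell=1,\dots,k$): (i) $\mathrm{b}^{(\ell)}\in\operatorname{range}\big(Y^{(\ell)}\big)$; (ii) $\operatorname{rank}\big(Y^{(\ell)}\big)=\ell+1$; (iii) $y^{(i)}\in(0,\bar y)$ for the observed responses $y^{(i)}$, $i=0,\dots,\ell$; (iv) $\tilde{\mathrm{b}}^{(\ell+1)}\in\operatorname{range}\big(A^{(\ell+1)}\big)$. Then after $k$ iterations the satisfaction function is known exactly, i.e. $\hat f^{(k)}=f$ on $Y$ up to the additive constant $f(0)$, and the incentive $\gamma^{(k+1)}$ induces the consumer to use the desired control, i.e. $(v^{(k+1),d},y^{(k+1),d})$ maximizes the true leader utility $J_L$ over $V\times Y$ and $$\arg\max_{y\in Y}J_F(\gamma^{(k+1)}(y),y)=y^{(k+1),d},\qquad \gamma^{(k+1)}(y^{(k+1),d})=v^{(k+1),d}.$$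
   Context: Setting. A utility company (leader) offers incentives to a consumer (follower). Let $\bar y,\bar v>0$, $Y=[0,\bar y]$, $V=[0,\bar v]$; $p$ is the known price of energy, $\beta$ a known constant, $g$ a known concave function on $Y$, and $f:Y\to\mathbb{R}$ the consumer's concave satisfaction function, unknown to the leader. The true utilities are $$J_L(v,y)=g(y)-v+\beta f(y),\qquad J_F(\gamma(y),y)=-py+\gamma(y)+f(y).$$ The admissible incentives $\Gamma$ are the functions $\gamma(y)=\xi_1y+\xi_2y^2$ on $Y$ with $\xi_1,\xi_2\in\mathbb{R}$; write $\gamma^{(i)}(y)=\xi^{(i)}_1y+\xi^{(i)}_2y^2$. When $\gamma^{(i)}$ is issued, the consumer responds with some $y^{(i)}$ maximizing $J_F(\gamma^{(i)}(y),y)$ over $y\in Y$, which the leader observes. Algorithm. First $\gamma^{(0)}$ and $\gamma^{(1)}$ are issued and $y^{(0)},y^{(1)}$ observed. Iteration $\ell\ge1$ uses the data $\{(\gamma^{(i)},y^{(i)})\}_{i=0}^{\ell}$; the following describes it when all $y^{(i)}\in(0,\bar y)$. Put $$b^{(i)}=p-\big(\xi_1^{(i)}+2\xi_2^{(i)}y^{(i)}\big),\qquad \mathrm{b}^{(\ell)}=(b^{(0)},\dots,b^{(\ell)})^T.$$ For a given order $j$, let $Y^{(\ell)}$ be the $(\ell+1)\times(j+1)$ matrix whose row $i$ ($0\le i\le\ell$) is $$\big(1,\ 2y^{(i)},\ 3(y^{(i)})^2,\ \dots,\ (j+1)(y^{(i)})^j\big).$$ Estimation step: for $\ell=1$ take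 $j=1$; for $\ell\ge2$, starting with $j=2$, increase $j$ until $\mathrm{b}^{(\ell)}\in\operatorname{range}(Y^{(\ell)})$ or $j=\ell$ is reached. If $\mathrm{b}^{(\ell)}\notin\operatorname{range}(Y^{(\ell)})$ for all these $j$, terminate. From here on (and in the hypotheses) $Y^{(\ell)}$ denotes the matrix for the order $j$ so selected. Solve $Y^{(\ell)}\alpha=\mathrm{b}^{(\ell)}$ for $\alpha=(\alpha_0,\dots,\alpha_j)^T$ and set $\hat f^{(\ell)}(y)=\sum_{i=0}^{j}\alpha_iy^{i+1}$, $\hat J_L^{(\ell)}(v,y)=g(y)-v+\beta\hat f^{(\ell)}(y)$, $\hat J_F^{(\ell)}(\gamma(y),y)=-py+\gamma(y)+\hat f^{(\ell)}(y)$. Incentive design step: let $(v^{(\ell+1),d},y^{(\ell+1),d})$ be a maximizer of $\hat J_L^{(\ell)}$ over $V\times Y$ (the desired choice). The leader seeks $\gamma^{(\ell+1)}\in\Gamma$ with $\arg\max_{y\in Y}\hat J_F^{(\ell)}(\gamma^{(\ell+1)}(y),y)=y^{(\ell+1),d}$ and $\gamma^{(\ell+1)}(y^{(\ell+1),d})=v^{(\ell+1),d}$. If $y^{(\ell+1),d}\notin(0,\bar y)$, terminate. If $y^{(\ell+1),d}\in(0,\bar y)$, this problem is replaced by the first-order condition together with the second equation, i.e. $\gamma^{(\ell+1)}$ is obtained by solving the linear system $A^{(\ell+1)}\xi^{(\ell+1)}=\tilde{\mathrm{b}}^{(\ell+1)}$ for $\xi^{(\ell+1)}=(\xi_1^{(\ell+1)},\xi_2^{(\ell+1)})^T$,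 where $$A^{(\ell+1)}=\begin{bmatrix}1&2y^{(\ell+1),d}\\ y^{(\ell+1),d}&(y^{(\ell+1),d})^2\end{bmatrix},\qquad \tilde{\mathrm{b}}^{(\ell+1)}=\begin{bmatrix}p-(\hat f^{(\ell)})'(y^{(\ell+1),d})\\ v^{(\ell+1),d}\end{bmatrix}.$$ Then issue $\gamma^{(\ell+1)}$, observe $y^{(\ell+1)}$ and go to iteration $\ell+1$.
   Formalization: The claim that y^{(k+1),d} is the unique maximizer of J_F under γ^{(k+1)} can fail (it may be a minimum), so it is stated only when vanishing of the derivative of the estimated follower utility at y^{(k+1),d} suffices for it to be that utility's unique maximizer over Y. *)

theory Defs
  imports
    "HOL-Analysis.Derivative"
    "Jordan_Normal_Form.DL_Rank"
begin

no_notation vec_nth (infixl "$" 90)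

definition arg_max_set :: "'a set \<Rightarrow> ('a \<Rightarrow> real) \<Rightarrow> 'a set" where
  "arg_max_set S h = {x. is_arg_max h (\<lambda>z. z \<in> S) x}"

definition leader_utility ::
  "(real \<Rightarrow> real) \<Rightarrow> real \<Rightarrow> (real \<Rightarrow> real) \<Rightarrow> real \<Rightarrow> real \<Rightarrow> real" where
  "leader_utility g \<beta> f v y = g y - v + \<beta> * f y"

text \<open>The first argument of \<open>follower_utility p f\<close> is the amount paid by the leader, so
  \<open>J_F(\<gamma>(y), y)\<close> is written \<open>follower_utility p f (\<gamma> y) y\<close>.\<close>

definition follower_utility :: "real \<Rightarrow> (real \<Rightarrow> real) \<Rightarrow> real \<Rightarrow> real \<Rightarrow> real" where
  "follower_utility p f v y = - p * y + v + f y"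

text \<open>An admissible incentive is given by its coefficient vector in \<open>carrier_vec 2\<close>; the entries
  \<open>\<xi> $ 0\<close> and \<open>\<xi> $ 1\<close> are the coefficients of \<open>y\<close> and \<open>y\<^sup>2\<close>.\<close>

definition incentive :: "real vec \<Rightarrow> real \<Rightarrow> real" where
  "incentive \<xi> y = \<xi> $ 0 * y + \<xi> $ 1 * y\<^sup>2"

definition data_vec :: "real \<Rightarrow> (nat \<Rightarrow> real vec) \<Rightarrow> (nat \<Rightarrow> real) \<Rightarrow> nat \<Rightarrow> real vec" where
  "data_vec p \<xi> y l = vec (l + 1) (\<lambda>i. p - (\<xi> i $ 0 + 2 * \<xi> i $ 1 * y i))"

definition data_mat_of_order :: "(nat \<Rightarrow> real) \<Rightarrow> nat \<Rightarrow> nat \<Rightarrow> real mat" where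
  "data_mat_of_order y l j = mat (l + 1) (j + 1) (\<lambda>(i, c). real (c + 1) * y i ^ c)"

abbreviation mat_range :: "real mat \<Rightarrow> real vec set" where
  "mat_range A \<equiv> vec_space.col_space (dim_row A) A"

abbreviation mat_rank :: "real mat \<Rightarrow> nat" where
  "mat_rank A \<equiv> vec_space.rank (dim_row A) A"

text \<open>For \<open>l \<ge> 2\<close> the order starts at \<open>2\<close> and is increased until the data fit or \<open>l\<close> is reached;
  in the latter case the selected order is \<open>l\<close> whether or not the data fit.\<close>

definition selected_order :: "real \<Rightarrow> (nat \<Rightarrow> real vec) \<Rightarrow> (nat \<Rightarrow> real) \<Rightarrow> nat \<Rightarrow> nat" where
  "selected_order p \<xi> y l =
     (if l = 1 then 1
      else LEAST j. 2 \<le> j \<and> (data_vec p \<xi> y l \<in> mat_range (data_mat_of_order y l j) \<or> j = l))"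

definition data_mat :: "real \<Rightarrow> (nat \<Rightarrow> real vec) \<Rightarrow> (nat \<Rightarrow> real) \<Rightarrow> nat \<Rightarrow> real mat" where
  "data_mat p \<xi> y l = data_mat_of_order y l (selected_order p \<xi> y l)"

definition estimate :: "real vec \<Rightarrow> real \<Rightarrow> real" where
  "estimate \<alpha> y = (\<Sum>i<dim_vec \<alpha>. \<alpha> $ i * y ^ (i + 1))"

definition design_mat :: "real \<Rightarrow> real mat" where
  "design_mat yd = mat_of_rows_list 2 [[1, 2 * yd], [yd, yd\<^sup>2]]"

definition design_vec :: "real \<Rightarrow> (real \<Rightarrow> real) \<Rightarrow> real \<Rightarrow> real \<Rightarrow> real vec" where
  "design_vec p fhat vd yd = vec_of_list [p - deriv fhat yd, vd]"

text \<open>The first-order condition for maximizing \<open>h\<close> over \<open>S\<close> is sufficient at \<open>x\<close>: if it holds there,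
  then \<open>x\<close> is the unique maximizer.  For interior \<open>x\<close> this is the case whenever \<open>h\<close> is strictly
  concave on \<open>S\<close>, but a convex quadratic term in an incentive can make it fail.\<close>

definition first_order_sufficient :: "real set \<Rightarrow> (real \<Rightarrow> real) \<Rightarrow> real \<Rightarrow> bool" where
  "first_order_sufficient S h x \<longleftrightarrow>
     ((h has_real_derivative 0) (at x) \<longrightarrow> arg_max_set S h = {x})"

end

theory Submission
  imports Defs
begin

text \<open>An interior response to an incentive satisfies the first-order condition, so each observation
  is a sample of the polynomial \<open>f'\<close>. At iteration \<open>k\<close> the rank condition leaves room only for the
  order \<open>k\<close> and makes the linear system uniquely solvable; since the coefficients of \<open>f\<close> solve it,
  the estimate equals \<open>f\<close> up to a constant, which changes no maximizer.\<close>

text \<open>A constant shift preserves every comparison of values inside \<open>S\<close>. With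
  \<open>c = 0\<close> this also exchanges functions that agree only on \<open>S\<close>.\<close>

lemma arg_max_set_cong_add_const:
  assumes "\<And>x. x \<in> S \<Longrightarrow> h' x = h x + c"
  shows "arg_max_set S h' = arg_max_set S h"
  using assms by (auto simp: arg_max_set_def is_arg_max_def)

text \<open>For \<open>l\<close> at least 2 the order \<open>l\<close> itself satisfies the stopping
  condition, so the least such order cannot exceed it.\<close>

lemma selected_order_le:
  assumes "1 \<le> l"
  shows "selected_order p \<xi> y l \<le> l"
  using assms by (auto simp: selected_order_def intro: Least_le)

lemma has_real_derivative_incentive:
  "(incentive \<xi> has_real_derivative \<xi> $ 0 + 2 * \<xi> $ 1 * x) (at x)"
  unfolding incentive_def[abs_def] by (auto intro!: derivative_eq_intros)

lemma has_real_derivative_estimate: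
  "(estimate \<alpha> has_real_derivative (\<Sum>i<dim_vec \<alpha>. real (i + 1) * \<alpha> $ i * x ^ i)) (at x)"
  unfolding estimate_def[abs_def]
proof (rule DERIV_sum)
  fix i
  show "((\<lambda>x. \<alpha> $ i * x ^ (i + 1)) has_real_derivative real (i + 1) * \<alpha> $ i * x ^ i) (at x)"
    using DERIV_cmult[OF DERIV_pow[of "i + 1" x], of "\<alpha> $ i"] by (simp add: mult_ac)
qed

lemma has_real_derivative_follower_utility:
  assumes "(f has_real_derivative d) (at x)"
  shows "((\<lambda>x. follower_utility p f (incentive \<xi> x) x) has_real_derivative
    - p + (\<xi> $ 0 + 2 * \<xi> $ 1 * x) + d) (at x)"
  unfolding follower_utility_def[abs_def]
  by (auto intro!: derivative_eq_intros has_real_derivative_incentive assms)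

text \<open>This is Fermat's rule at an interior maximizer. Since \<open>f\<close> is controlled
  only on the interval, the rule is applied to the utility built from the polynomial
  \<open>q\<close>, which is differentiable on the whole line.\<close>

lemma interior_response_first_order:
  assumes max: "y \<in> arg_max_set {0..b} (\<lambda>x. follower_utility p f (incentive \<xi> x) x)"
    and y: "y \<in> {0<..<b}"
    and f: "\<And>x. x \<in> {0..b} \<Longrightarrow> f x = poly q x"
  shows "poly (pderiv q) y = p - (\<xi> $ 0 + 2 * \<xi> $ 1 * y)"
proof -
  let ?J = "\<lambda>x. follower_utility p (poly q) (incentive \<xi> x) x"
  have "y \<in> arg_max_set {0..b} ?J"
    using max arg_max_set_cong_add_const[of "{0..b}" ?J
        "\<lambda>x. follower_utility p f (incentive \<xi> x) x" 0]
    by (simp add: follower_utility_def f)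
  then have max': "?J x \<le> ?J y" if "x \<in> {0..b}" for x
    using that by (auto simp: arg_max_set_def is_arg_max_def not_less)
  have "(?J has_real_derivative - p + (\<xi> $ 0 + 2 * \<xi> $ 1 * y) + poly (pderiv q) y) (at y)"
    by (intro has_real_derivative_follower_utility poly_DERIV)
  \<comment> \<open>This radius keeps the neighbourhood of \<open>y\<close> inside the interval,
    where maximality is known.\<close>
  moreover have "0 < min y (b - y)"
    using y by simp
  moreover have "\<forall>x. \<bar>y - x\<bar> < min y (b - y) \<longrightarrow> ?J x \<le> ?J y"
    by (auto intro!: max')
  ultimately have "- p + (\<xi> $ 0 + 2 * \<xi> $ 1 * y) + poly (pderiv q) y = 0"
    by (rule DERIV_local_max)
  then show ?thesis by simp
qed

text \<open>The index shift drops the constant coefficient: the ansatz \<open>estimate\<close> has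
  no constant term, and observed slopes cannot reveal one.\<close>

definition poly_coeff_vec :: "nat \<Rightarrow> real poly \<Rightarrow> real vec" where
  "poly_coeff_vec k q = vec (k + 1) (\<lambda>i. coeff q (i + 1))"

lemma estimate_poly_coeff_vec:
  assumes "degree q = k + 1"
  shows "estimate (poly_coeff_vec k q) x = poly q x - poly q 0"
proof -
  have "poly q x = (\<Sum>i\<le>Suc k. coeff q i * x ^ i)"
    using assms by (simp add: poly_altdef)
  also have "\<dots> = coeff q 0 + (\<Sum>i\<le>k. coeff q (Suc i) * x ^ Suc i)"
    by (subst sum.atMost_Suc_shift) simp
  finally show ?thesis
    by (simp add: estimate_def poly_coeff_vec_def poly_0_coeff_0 lessThan_Suc_atMost)
qed

text \<open>Column \<open>c\<close> of the data matrix samples the derivative of the monomial of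
  degree \<open>c + 1\<close>, so multiplying by the shifted coefficients evaluates
  \<open>pderiv q\<close> at the responses.\<close>

lemma data_mat_of_order_mult_poly_coeff_vec:
  assumes "degree q = k + 1" and "i \<le> l"
  shows "(data_mat_of_order y l k *\<^sub>v poly_coeff_vec k q) $ i = poly (pderiv q) (y i)"
proof -
  have "poly (pderiv q) (y i) = (\<Sum>c\<le>k. real (c + 1) * y i ^ c * coeff q (c + 1))"
    using assms by (simp add: poly_altdef degree_pderiv coeff_pderiv mult_ac)
  then show ?thesis
    using assms
    by (simp add: data_mat_of_order_def poly_coeff_vec_def scalar_prod_def
        atLeast0LessThan lessThan_Suc_atMost)
qed

text \<open>A square matrix of full rank has nonzero determinant, so the difference
  \<open>u - v\<close> in its kernel vanishes.\<close>

lemma full_rank_mult_mat_vec_cancel: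
  fixes A :: "real mat"
  assumes A: "A \<in> carrier_mat n n" and rank: "mat_rank A = n"
    and u: "u \<in> carrier_vec n" and v: "v \<in> carrier_vec n"
    and eq: "A *\<^sub>v u = A *\<^sub>v v"
  shows "u = v"
proof -
  have "det A \<noteq> 0"
    using A rank by (simp add: vec_space.det_rank_iff)
  moreover have "A *\<^sub>v (u - v) = 0\<^sub>v n"
    using A u v eq by (simp add: mult_minus_distrib_mat_vec)
  moreover have "u - v \<in> carrier_vec n"
    using u v by simp
  ultimately have "u - v = 0\<^sub>v n"
    using det_0_iff_vec_prod_zero[OF A] by blast
  then show ?thesis
    using u v by (metis minus_cancel_vec minus_zero_vec carrier_vecD eq_vecI index_minus_vec(1)
        index_zero_vec(1) right_minus_eq)
qed

text \<open>The first row of the design system carries the slope of the incentive at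
  \<open>yd\<close>, the second its payment there.\<close>

lemma design_mat_mult_vec:
  assumes "\<xi> \<in> carrier_vec 2"
  shows "(design_mat yd *\<^sub>v \<xi>) $ 0 = \<xi> $ 0 + 2 * \<xi> $ 1 * yd"
    and "(design_mat yd *\<^sub>v \<xi>) $ 1 = incentive \<xi> yd"
  using assms
  by (simp_all add: design_mat_def mat_of_rows_list_def scalar_prod_def incentive_def
      numeral_2_eq_2 mult_ac)

theorem proposition1:
  fixes ybar vbar p \<beta> :: real
    and f g :: "real \<Rightarrow> real"
    and k :: nat
    and \<xi> :: "nat \<Rightarrow> real vec"
    and y yd vd :: "nat \<Rightarrow> real"
    and \<alpha> :: "nat \<Rightarrow> real vec"
  defines "Y \<equiv> {0..ybar}" and "V \<equiv> {0..vbar}"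
  assumes ybar_pos: "0 < ybar" and vbar_pos: "0 < vbar"
    and g_concave: "concave_on Y g"
    and f_concave: "concave_on Y f"
    and k_ge_1: "1 \<le> k"
    and f_poly: "\<exists>q :: real poly. degree q = k + 1 \<and> (\<forall>x\<in>Y. f x = poly q x)"
    and y0: "y 0 \<in> {0<..<ybar}"
    and admissible: "\<And>i. i \<le> k + 1 \<Longrightarrow> \<xi> i \<in> carrier_vec 2"
    and response: "\<And>i. i \<le> k + 1 \<Longrightarrow>
      y i \<in> arg_max_set Y (\<lambda>x. follower_utility p f (incentive (\<xi> i) x) x)"
    and estimation: "\<And>l. l \<in> {1..k} \<Longrightarrow>
      \<alpha> l \<in> carrier_vec (selected_order p \<xi> y l + 1) \<and>
      data_mat p \<xi> y l *\<^sub>v \<alpha> l = data_vec p \<xi> y l"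
    and desired: "\<And>l. l \<in> {1..k} \<Longrightarrow>
      (vd (l + 1), yd (l + 1)) \<in>
        arg_max_set (V \<times> Y) (\<lambda>(v, x). leader_utility g \<beta> (estimate (\<alpha> l)) v x)"
    and not_terminated: "\<And>l. l \<in> {1..k} \<Longrightarrow> yd (l + 1) \<in> {0<..<ybar}"
    and design: "\<And>l. l \<in> {1..k} \<Longrightarrow>
      design_mat (yd (l + 1)) *\<^sub>v \<xi> (l + 1) =
        design_vec p (estimate (\<alpha> l)) (vd (l + 1)) (yd (l + 1))"
    and i: "\<And>l. l \<in> {1..k} \<Longrightarrow> data_vec p \<xi> y l \<in> mat_range (data_mat p \<xi> y l)"
    and ii: "\<And>l. l \<in> {1..k} \<Longrightarrow> mat_rank (data_mat p \<xi> y l) = l + 1"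
    and iii: "\<And>l. l \<in> {1..k} \<Longrightarrow> \<forall>i\<le>l. y i \<in> {0<..<ybar}"
    and iv: "\<And>l. l \<in> {1..k} \<Longrightarrow>
      design_vec p (estimate (\<alpha> l)) (vd (l + 1)) (yd (l + 1))
        \<in> mat_range (design_mat (yd (l + 1)))"
  shows
    "(\<forall>x\<in>Y. estimate (\<alpha> k) x = f x - f 0) \<and>
     (vd (k + 1), yd (k + 1)) \<in> arg_max_set (V \<times> Y) (\<lambda>(v, x). leader_utility g \<beta> f v x) \<and>
     (first_order_sufficient Y
        (\<lambda>x. follower_utility p (estimate (\<alpha> k)) (incentive (\<xi> (k + 1)) x) x) (yd (k + 1)) \<longrightarrow>
      arg_max_set Y (\<lambda>x. follower_utility p f (incentive (\<xi> (k + 1)) x) x) = {yd (k + 1)}) \<and>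
     incentive (\<xi> (k + 1)) (yd (k + 1)) = vd (k + 1)"
proof -
  obtain q where deg: "degree q = k + 1" and f_eq: "\<And>x. x \<in> Y \<Longrightarrow> f x = poly q x"
    using f_poly by blast
  let ?j = "selected_order p \<xi> y k"
  let ?M = "data_mat p \<xi> y k"
  have k: "k \<in> {1..k}"
    using k_ge_1 by simp
  \<comment> \<open>The rank \<open>k + 1\<close> cannot exceed the number of columns
    \<open>?j + 1\<close>; with the upper bound on the selected order this makes the matrix
    square.\<close>
  have "k + 1 \<le> ?j + 1"
  proof -
    have M: "?M \<in> carrier_mat (k + 1) (?j + 1)"
      by (simp add: data_mat_def data_mat_of_order_def)
    then have "mat_rank ?M \<le> ?j + 1"
      using vec_space.rank_le_nc[OF M] by simp
    then show ?thesis
      using ii[OF k] by simp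
  qed
  then have j: "?j = k"
    using selected_order_le[OF k_ge_1, of p \<xi> y] by simp
  have M_eq: "?M = data_mat_of_order y k k"
    by (simp add: data_mat_def j)
  have M: "?M \<in> carrier_mat (k + 1) (k + 1)"
    by (simp add: M_eq data_mat_of_order_def)
  have "?M *\<^sub>v poly_coeff_vec k q = data_vec p \<xi> y k"
  proof (rule eq_vecI)
    fix i assume "i < dim_vec (data_vec p \<xi> y k)"
    then have i: "i \<le> k"
      by (simp add: data_vec_def)
    have "poly (pderiv q) (y i) = p - (\<xi> i $ 0 + 2 * \<xi> i $ 1 * y i)"
    proof (rule interior_response_first_order)
      show "y i \<in> arg_max_set {0..ybar} (\<lambda>x. follower_utility p f (incentive (\<xi> i) x) x)"
        using response[of i] i by (simp add: Y_def)
      show "y i \<in> {0<..<ybar}"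
        using iii[OF k] i by blast
      show "f x = poly q x" if "x \<in> {0..ybar}" for x
        using f_eq that by (simp add: Y_def)
    qed
    then show "(?M *\<^sub>v poly_coeff_vec k q) $ i = data_vec p \<xi> y k $ i"
      using i data_mat_of_order_mult_poly_coeff_vec[OF deg i, of y]
      by (simp add: M_eq data_vec_def)
  qed (simp add: M_eq data_mat_of_order_def data_vec_def)
  then have "\<alpha> k = poly_coeff_vec k q"
    using full_rank_mult_mat_vec_cancel[OF M ii[OF k]] estimation[OF k]
    by (simp add: j poly_coeff_vec_def)
  \<comment> \<open>Positivity of \<open>ybar\<close> puts 0 in \<open>Y\<close>, so the lost
    constant \<open>poly q 0\<close> equals \<open>f 0\<close>.\<close>
  then have est: "estimate (\<alpha> k) x = f x - f 0" if "x \<in> Y" for x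
    using that estimate_poly_coeff_vec[OF deg] f_eq[of x] f_eq[of 0] ybar_pos
    by (simp add: Y_def)

  have "arg_max_set (V \<times> Y) (\<lambda>(v, x). leader_utility g \<beta> (estimate (\<alpha> k)) v x) =
      arg_max_set (V \<times> Y) (\<lambda>(v, x). leader_utility g \<beta> f v x)"
    \<comment> \<open>The offset \<open>f 0\<close> of the estimate enters the leader's utility
      multiplied by \<open>\<beta>\<close>.\<close>
    by (rule arg_max_set_cong_add_const[where c = "- \<beta> * f 0"])
      (auto simp: leader_utility_def est algebra_simps)
  then have leader: "(vd (k + 1), yd (k + 1)) \<in>
      arg_max_set (V \<times> Y) (\<lambda>(v, x). leader_utility g \<beta> f v x)"
    using desired[OF k] by simp

  let ?x = "yd (k + 1)" and ?\<xi> = "\<xi> (k + 1)"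
  let ?Jhat = "\<lambda>x. follower_utility p (estimate (\<alpha> k)) (incentive ?\<xi> x) x"
  have \<xi>: "?\<xi> \<in> carrier_vec 2"
    using admissible by simp
  have first: "- p + (?\<xi> $ 0 + 2 * ?\<xi> $ 1 * ?x) + deriv (estimate (\<alpha> k)) ?x = 0"
    using design_mat_mult_vec(1)[OF \<xi>, of ?x] design[OF k]
    by (simp add: design_vec_def)
  have second: "incentive ?\<xi> ?x = vd (k + 1)"
    using design_mat_mult_vec(2)[OF \<xi>, of ?x] design[OF k]
    by (simp add: design_vec_def)
  \<comment> \<open>Differentiability of the polynomial estimate is what makes \<open>deriv\<close>
    in the design equation its actual derivative.\<close>
  have "(estimate (\<alpha> k) has_real_derivative deriv (estimate (\<alpha> k)) ?x) (at ?x)"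
    using has_real_derivative_estimate DERIV_imp_deriv by metis
  from has_real_derivative_follower_utility[OF this, of p ?\<xi>]
  have "(?Jhat has_real_derivative 0) (at ?x)"
    by (simp only: first)
  \<comment> \<open>Stationarity is the premise in \<open>first_order_sufficient\<close>, which
    yields the unique maximizer of the estimated utility; this equality carries it over to the true
    one.\<close>
  moreover have "arg_max_set Y ?Jhat =
      arg_max_set Y (\<lambda>x. follower_utility p f (incentive ?\<xi> x) x)"
    by (rule arg_max_set_cong_add_const[where c = "- f 0"]) (simp add: follower_utility_def est)
  ultimately show ?thesis
    using est leader second by (simp add: first_order_sufficient_def)
qed

end
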